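(* Let $A(x)=\sum_{n\ge 1}A_n x^n$ be the ordinary generating function of the numbers $A_n$. Then, as formal power series, $$A(x)=\frac{-x^6 + x^5 - 3x^4 + 2x^3 - x^2 + x}{(1-x)^2(1-x-x^3)}.$$
   Context: $S_n$ is the set of permutations of $\{1,\dots,n\}$ written in one-line notation. A permutation $\pi\in S_n$ avoids $132$ if there are no indices $i<j<k$ with $\pi_i<\pi_k<\pi_j$. For $n\ge 1$, $A_n$ denotes the number of $\pi\in S_n$ that avoid $132$ and satisfy $|\pi_{i+1}-\pi_i|\le 2$ for all $1\le i<n$. *)

theory Defs
  imports
    "HOL-Combinatorics.Multiset_Permutations"
    "HOL-Computational_Algebra.Formal_Power_Series"
begin

text \<open>
  Permutations in one-line notation are lists in \<^term>\<open>permutations_of_set {1..n}\<close>.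
  List positions are counted from 0, so \<open>xs ! i\<close> is the entry at index \<open>i + 1\<close>
  of the permutation.
\<close>

definition avoids_132 :: "nat list \<Rightarrow> bool" where
  "avoids_132 xs \<longleftrightarrow>
     \<not> (\<exists>i j k. i < j \<and> j < k \<and> k < length xs \<and> xs ! i < xs ! k \<and> xs ! k < xs ! j)"

definition adjacent_diffs_le_2 :: "nat list \<Rightarrow> bool" where
  "adjacent_diffs_le_2 xs \<longleftrightarrow>
     (\<forall>i. i + 1 < length xs \<longrightarrow> \<bar>int (xs ! (i + 1)) - int (xs ! i)\<bar> \<le> 2)"

definition A_num :: "nat \<Rightarrow> nat" where
  "A_num n = card {xs \<in> permutations_of_set {1..n}. avoids_132 xs \<and> adjacent_diffs_le_2 xs}"

text \<open>
  The generating function starts at \<open>n = 1\<close>; since the empty permutation gives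
  \<open>A_num 0 = 1\<close>, the constant coefficient has to be set to 0 explicitly.
\<close>

definition A_gf :: "rat fps" where
  "A_gf = Abs_fps (\<lambda>n. if n \<ge> 1 then of_nat (A_num n) else 0)"

end

theory Submission
  imports Defs
begin

text \<open>
  Avoiding 132 forces every entry before the maximum \<open>n\<close> to exceed every entry after it. If there
  are entries on both sides, then the bound on adjacent differences leaves only \<open>n - 1\<close> in front of
  \<open>n\<close>, followed by \<open>n - 2\<close>. So \<open>n\<close> is last, or first, or the permutation is \<open>n - 1, n\<close> followed by a
  good permutation of \<open>n - 2\<close> starting with its maximum. The permutations with \<open>n\<close> in last place
  number \<open>n - 1\<close>, and those with \<open>n\<close> in first place satisfy
  \<open>F n = F (n - 1) + F (n - 3) + 1\<close>; hence the factors \<open>(1 - x)\<^sup>2\<close> and \<open>1 - x - x\<^sup>3\<close>.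
\<close>

section \<open>Avoidance and adjacent differences when lists are extended or joined\<close>

text \<open>A new first entry can only play the 1 of a 132 pattern, which takes two different larger
  values. The assumption ignores positions and allows at most one larger value, so it fits both a
  maximum and an entry just below the maximum.\<close>

lemma avoids_132_Cons:
  assumes "\<And>b c. b \<in> set xs \<Longrightarrow> c \<in> set xs \<Longrightarrow> x < c \<Longrightarrow> \<not> c < b"
  shows "avoids_132 (x # xs) \<longleftrightarrow> avoids_132 xs"
proof
  assume a: "avoids_132 (x # xs)"
  show "avoids_132 xs"
    unfolding avoids_132_def
  proof clarify
    fix i j k assume "i < j" "j < k" "k < length xs" "xs ! i < xs ! k" "xs ! k < xs ! j"
    then have "Suc i < Suc j \<and> Suc j < Suc k \<and> Suc k < length (x # xs) \<and>
        (x # xs) ! Suc i < (x # xs) ! Suc k \<and> (x # xs) ! Suc k < (x # xs) ! Suc j"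
      by simp
    with a show False unfolding avoids_132_def by blast
  qed
next
  assume a: "avoids_132 xs"
  show "avoids_132 (x # xs)"
    unfolding avoids_132_def
  proof clarify
    fix i j k
    assume h: "i < j" "j < k" "k < length (x # xs)"
      "(x # xs) ! i < (x # xs) ! k" "(x # xs) ! k < (x # xs) ! j"
    obtain j' k' where jk: "j = Suc j'" "k = Suc k'"
      using h by (cases j; cases k) auto
    show False
    proof (cases i)
      case 0
      then show False using h jk assms[of "xs ! j'" "xs ! k'"] by auto
    next
      case (Suc i')
      then show False using h jk a unfolding avoids_132_def by auto
    qed
  qed
qed

text \<open>A new last entry can only play the 2 of a pattern, which needs a larger entry before
  it.\<close>

lemma avoids_132_snoc:
  assumes "\<And>b. b \<in> set xs \<Longrightarrow> b \<le> c"
  shows "avoids_132 (xs @ [c]) \<longleftrightarrow> avoids_132 xs"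
proof
  assume a: "avoids_132 (xs @ [c])"
  show "avoids_132 xs"
    unfolding avoids_132_def
  proof clarify
    fix i j k assume "i < j" "j < k" "k < length xs" "xs ! i < xs ! k" "xs ! k < xs ! j"
    then have "i < j \<and> j < k \<and> k < length (xs @ [c]) \<and>
        (xs @ [c]) ! i < (xs @ [c]) ! k \<and> (xs @ [c]) ! k < (xs @ [c]) ! j"
      by (simp add: nth_append)
    with a show False unfolding avoids_132_def by blast
  qed
next
  assume a: "avoids_132 xs"
  show "avoids_132 (xs @ [c])"
    unfolding avoids_132_def
  proof clarify
    fix i j k
    assume h: "i < j" "j < k" "k < length (xs @ [c])"
      "(xs @ [c]) ! i < (xs @ [c]) ! k" "(xs @ [c]) ! k < (xs @ [c]) ! j"
    have "xs ! j \<le> c" using h by (intro assms nth_mem) auto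
    then have "k < length xs" using h by (auto simp: nth_append split: if_splits)
    then show False using h a unfolding avoids_132_def by (auto simp: nth_append)
  qed
qed

text \<open>Otherwise \<open>a\<close>, \<open>b\<close>, \<open>c\<close> would form a 132 pattern
  with \<open>b\<close> as the 3. Taking the maximum for \<open>b\<close> separates the values
  before it from those after it.\<close>

lemma avoids_132_appendD:
  assumes "avoids_132 (us @ b # vs)" "a \<in> set us" "c \<in> set vs" "c < b"
  shows "c \<le> a"
proof (rule ccontr)
  assume "\<not> c \<le> a"
  obtain i k where i: "i < length us" "us ! i = a" and k: "k < length vs" "vs ! k = c"
    using assms by (auto simp: in_set_conv_nth)
  let ?xs = "us @ b # vs" and ?j = "length us" and ?k = "Suc (length us + k)"
  have "i < ?j \<and> ?j < ?k \<and> ?k < length ?xs \<and> ?xs ! i < ?xs ! ?k \<and> ?xs ! ?k < ?xs ! ?j"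
    using i k assms \<open>\<not> c \<le> a\<close> by (simp add: nth_append)
  with assms(1) show False unfolding avoids_132_def by blast
qed

text \<open>Recast through \<open>successively\<close>, the condition on a joined list adds only the
  pair at the seam.\<close>

lemma adjacent_diffs_append:
  "adjacent_diffs_le_2 (us @ vs) \<longleftrightarrow> adjacent_diffs_le_2 us \<and> adjacent_diffs_le_2 vs \<and>
     (us \<noteq> [] \<longrightarrow> vs \<noteq> [] \<longrightarrow> \<bar>int (hd vs) - int (last us)\<bar> \<le> 2)"
proof -
  have "adjacent_diffs_le_2 = successively (\<lambda>x y. \<bar>int y - int x\<bar> \<le> 2)"
    by (auto simp: fun_eq_iff adjacent_diffs_le_2_def successively_conv_nth)
  then show ?thesis by (metis successively_append_iff)
qed

lemma adjacent_diffs_singleton [simp]: "adjacent_diffs_le_2 [x]"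
  by (simp add: adjacent_diffs_le_2_def)

section \<open>Good permutations and the removal of their maximum\<close>

definition good_perms :: "nat \<Rightarrow> nat list set" where
  "good_perms n = {xs \<in> permutations_of_set {1..n}. avoids_132 xs \<and> adjacent_diffs_le_2 xs}"

lemma finite_good_perms [simp]: "finite (good_perms n)"
  by (simp add: good_perms_def)

lemma set_good_perms: "xs \<in> good_perms n \<Longrightarrow> set xs = {1..n}"
  by (simp add: good_perms_def permutations_of_set_def)

lemma good_perms_not_Nil: "xs \<in> good_perms n \<Longrightarrow> n \<ge> 1 \<Longrightarrow> xs \<noteq> []"
  by (auto dest: set_good_perms)

lemma hd_good_perms_le: "xs \<in> good_perms n \<Longrightarrow> n \<ge> 1 \<Longrightarrow> hd xs \<le> n"
  using good_perms_not_Nil[of xs n] hd_in_set[of xs] set_good_perms[of xs n] by auto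

lemma last_good_perms_le: "xs \<in> good_perms n \<Longrightarrow> n \<ge> 1 \<Longrightarrow> last xs \<le> n"
  using good_perms_not_Nil[of xs n] last_in_set[of xs] set_good_perms[of xs n] by auto

lemma insert_Suc_eq_atLeastAtMost_iff:
  "Suc n \<notin> A \<Longrightarrow> insert (Suc n) A = {1..Suc n} \<longleftrightarrow> A = {1..n}"
  by (simp add: atLeastAtMostSuc_conv insert_ident)

text \<open>A leading maximum creates no 132 pattern, so only the first difference counts. Since
  \<open>hd ys\<close> is at most \<open>n\<close>, it is within 2 of \<open>Suc n\<close> exactly
  when it is at least \<open>n - 1\<close>. The additive form avoids truncated subtraction, and
  \<open>n \<ge> 1\<close> makes \<open>ys\<close> nonempty.\<close>

lemma Cons_good_perms_iff:
  assumes "n \<ge> 1"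
  shows "Suc n # ys \<in> good_perms (Suc n) \<longleftrightarrow> ys \<in> good_perms n \<and> n \<le> hd ys + 1"
proof -
  have s: "set (Suc n # ys) = {1..Suc n} \<and> distinct (Suc n # ys) \<longleftrightarrow> set ys = {1..n} \<and> distinct ys"
    using insert_Suc_eq_atLeastAtMost_iff[of n "set ys"] by auto
  show ?thesis
  proof (cases "set ys = {1..n}")
    case True
    then have ne: "ys \<noteq> []" using assms by auto
    have "hd ys \<in> {1..n}" using True hd_in_set[OF ne] by simp
    then have "adjacent_diffs_le_2 (Suc n # ys) \<longleftrightarrow> adjacent_diffs_le_2 ys \<and> n \<le> hd ys + 1"
      using ne adjacent_diffs_append[of "[Suc n]" ys] by auto
    moreover have "avoids_132 (Suc n # ys) \<longleftrightarrow> avoids_132 ys"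
      using True by (intro avoids_132_Cons) auto
    ultimately show ?thesis
      using s by (auto simp: good_perms_def permutations_of_set_def)
  next
    case False
    then show ?thesis using s by (auto simp: good_perms_def permutations_of_set_def)
  qed
qed

lemma snoc_good_perms_iff:
  assumes "n \<ge> 1"
  shows "ys @ [Suc n] \<in> good_perms (Suc n) \<longleftrightarrow> ys \<in> good_perms n \<and> n \<le> last ys + 1"
proof -
  have s: "set (ys @ [Suc n]) = {1..Suc n} \<and> distinct (ys @ [Suc n])
      \<longleftrightarrow> set ys = {1..n} \<and> distinct ys"
    using insert_Suc_eq_atLeastAtMost_iff[of n "set ys"] by auto
  show ?thesis
  proof (cases "set ys = {1..n}")
    case True
    then have ne: "ys \<noteq> []" using assms by auto
    have "last ys \<in> {1..n}" using True last_in_set[OF ne] by simp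
    then have "adjacent_diffs_le_2 (ys @ [Suc n]) \<longleftrightarrow> adjacent_diffs_le_2 ys \<and> n \<le> last ys + 1"
      using ne adjacent_diffs_append[of ys "[Suc n]"] by auto
    moreover have "avoids_132 (ys @ [Suc n]) \<longleftrightarrow> avoids_132 ys"
      using True by (intro avoids_132_snoc) auto
    ultimately show ?thesis
      using s by (auto simp: good_perms_def permutations_of_set_def)
  next
    case False
    then show ?thesis using s by (auto simp: good_perms_def permutations_of_set_def)
  qed
qed

text \<open>The entry \<open>Suc n\<close> has a single larger value and so starts no 132 pattern.
  The step down from \<open>Suc (Suc n)\<close> to an entry of \<open>ys\<close> has size at most 2
  only if that entry is \<open>n\<close>.\<close>

lemma Cons_Cons_good_perms_iff:
  assumes "n \<ge> 1"
  shows "Suc n # Suc (Suc n) # ys \<in> good_perms (Suc (Suc n)) \<longleftrightarrow> ys \<in> good_perms n \<and> hd ys = n"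
proof -
  have "set (Suc n # Suc (Suc n) # ys) = {1..Suc (Suc n)} \<and> distinct (Suc n # Suc (Suc n) # ys)
      \<longleftrightarrow> insert (Suc (Suc n)) (insert (Suc n) (set ys)) = {1..Suc (Suc n)}
        \<and> Suc (Suc n) \<notin> insert (Suc n) (set ys) \<and> Suc n \<notin> set ys \<and> distinct ys"
    by (auto simp: insert_commute)
  also have "\<dots> \<longleftrightarrow> set ys = {1..n} \<and> distinct ys"
    using insert_Suc_eq_atLeastAtMost_iff[of n "set ys"]
      insert_Suc_eq_atLeastAtMost_iff[of "Suc n" "insert (Suc n) (set ys)"] by auto
  finally have s: "set (Suc n # Suc (Suc n) # ys) = {1..Suc (Suc n)}
      \<and> distinct (Suc n # Suc (Suc n) # ys) \<longleftrightarrow> set ys = {1..n} \<and> distinct ys" .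
  show ?thesis
  proof (cases "set ys = {1..n}")
    case True
    then have ne: "ys \<noteq> []" using assms by auto
    have "hd ys \<in> {1..n}" using True hd_in_set[OF ne] by simp
    then have "adjacent_diffs_le_2 (Suc n # Suc (Suc n) # ys) \<longleftrightarrow>
        adjacent_diffs_le_2 ys \<and> hd ys = n"
      using ne adjacent_diffs_append[of "[Suc n]" "Suc (Suc n) # ys"]
        adjacent_diffs_append[of "[Suc (Suc n)]" ys] by auto
    moreover have "avoids_132 (Suc n # Suc (Suc n) # ys) \<longleftrightarrow> avoids_132 (Suc (Suc n) # ys)"
      using True by (intro avoids_132_Cons) auto
    moreover have "avoids_132 (Suc (Suc n) # ys) \<longleftrightarrow> avoids_132 ys"
      using True by (intro avoids_132_Cons) auto
    ultimately show ?thesis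
      using s by (auto simp: good_perms_def permutations_of_set_def)
  next
    case False
    then show ?thesis using s by (auto simp: good_perms_def permutations_of_set_def)
  qed
qed

lemma good_perms_cases:
  assumes "xs \<in> good_perms n" "n \<ge> 1"
  obtains (last) ys where "xs = ys @ [n]"
  | (hd) ys where "xs = n # ys"
  | (second) ys where "ys \<noteq> []" "xs = (n - 1) # n # ys"
proof -
  have s: "set xs = {1..n}" and d: "distinct xs" and av: "avoids_132 xs"
    and adj: "adjacent_diffs_le_2 xs"
    using assms by (auto simp: good_perms_def permutations_of_set_def)
  then have "n \<in> set xs" using assms by simp
  then obtain us vs where xs: "xs = us @ n # vs" by (auto simp: in_set_conv_decomp)
  show thesis
  proof (cases "us = [] \<or> vs = []")
    case True
    then show thesis using xs last hd by auto
  next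
    case False
    \<comment> \<open>Avoidance, with \<open>n\<close> as the 3, puts every entry before
      \<open>n\<close> above the entry right after it.\<close>
    have gt: "hd vs < a" and lt: "a < n" if "a \<in> set us" for a
    proof -
      have h: "hd vs \<in> set vs" using False by simp
      have "hd vs \<in> set xs" "a \<in> set xs" using h that xs by auto
      moreover have "hd vs \<noteq> n" "hd vs \<noteq> a" "a \<noteq> n" using d xs h that by auto
      ultimately have "hd vs < n" "a < n" using s by auto
      then show "a < n" "hd vs < a"
        using avoids_132_appendD[of us n vs a "hd vs"] av xs that h \<open>hd vs \<noteq> a\<close> by auto
    qed
    \<comment> \<open>The adjacent difference gives \<open>n - 2 \<le> hd vs < a < n\<close>, so
      \<open>a\<close> must be \<open>n - 1\<close>; by distinctness \<open>us\<close> then has just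
      one entry.\<close>
    have "adjacent_diffs_le_2 (n # vs)" using adj xs adjacent_diffs_append by blast
    then have "n \<le> hd vs + 2" using False adjacent_diffs_append[of "[n]" vs] by auto
    then have all: "a = n - 1" if "a \<in> set us" for a using gt[OF that] lt[OF that] by linarith
    obtain u us' where us: "us = u # us'" using False by (cases us) auto
    have "us' = []"
      using all d unfolding us xs by (cases us') auto
    then show thesis using second[of vs] False xs us all by auto
  qed
qed

section \<open>Counting good permutations by their end entries\<close>

definition max_first :: "nat \<Rightarrow> nat list set" where
  "max_first n = {xs \<in> good_perms n. hd xs = n}"

definition max_last :: "nat \<Rightarrow> nat list set" where
  "max_last n = {xs \<in> good_perms n. last xs = n}"

text \<open>For \<open>n = 1\<close> the value \<open>n - 1\<close> is 0, which is no entry, so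
  \<open>second_first 1\<close> is empty.\<close>

definition second_first :: "nat \<Rightarrow> nat list set" where
  "second_first n = {xs \<in> good_perms n. hd xs = n - 1}"

definition second_last :: "nat \<Rightarrow> nat list set" where
  "second_last n = {xs \<in> good_perms n. last xs = n - 1}"

lemma finite_max_second [simp]:
  "finite (max_first n)" "finite (max_last n)" "finite (second_first n)" "finite (second_last n)"
  by (simp_all add: max_first_def max_last_def second_first_def second_last_def)

text \<open>Once the leading maximum is removed, the next entry is at least \<open>n - 1\<close> and
  at most \<open>n\<close>, which leaves the two classes on the right.\<close>

lemma max_first_Suc:
  assumes "n \<ge> 1"
  shows "max_first (Suc n) = (#) (Suc n) ` (max_first n \<union> second_first n)" (is "?L = ?R")
proof
  show "?L \<subseteq> ?R"
  proof
    fix xs assume xs: "xs \<in> ?L"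
    then have "xs \<noteq> []" using good_perms_not_Nil[of xs "Suc n"] by (auto simp: max_first_def)
    with xs obtain ys where ys: "xs = Suc n # ys" by (cases xs) (auto simp: max_first_def)
    with xs assms have y: "ys \<in> good_perms n" "n \<le> hd ys + 1"
      by (auto simp: max_first_def Cons_good_perms_iff)
    then have "ys \<in> max_first n \<union> second_first n"
      using hd_good_perms_le[OF y(1) assms] by (auto simp: max_first_def second_first_def)
    then show "xs \<in> ?R" using ys by blast
  qed
  show "?R \<subseteq> ?L"
    using assms by (auto simp: max_first_def second_first_def Cons_good_perms_iff)
qed

lemma max_last_Suc:
  assumes "n \<ge> 1"
  shows "max_last (Suc n) = (\<lambda>ys. ys @ [Suc n]) ` (max_last n \<union> second_last n)" (is "?L = ?R")
proof
  show "?L \<subseteq> ?R"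
  proof
    fix xs assume xs: "xs \<in> ?L"
    then have "xs \<noteq> []" using good_perms_not_Nil[of xs "Suc n"] by (auto simp: max_last_def)
    with xs obtain ys where ys: "xs = ys @ [Suc n]"
      by (cases xs rule: rev_cases) (auto simp: max_last_def)
    with xs assms have y: "ys \<in> good_perms n" "n \<le> last ys + 1"
      by (auto simp: max_last_def snoc_good_perms_iff)
    then have "ys \<in> max_last n \<union> second_last n"
      using last_good_perms_le[OF y(1) assms] by (auto simp: max_last_def second_last_def)
    then show "xs \<in> ?R" using ys by blast
  qed
  show "?R \<subseteq> ?L"
    using assms by (auto simp: max_last_def second_last_def snoc_good_perms_iff)
qed

lemma good_perms_1: "good_perms 1 = {[1]}"
proof -
  have "avoids_132 [1]" by (simp add: avoids_132_def)
  then show ?thesis by (auto simp: good_perms_def)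
qed

text \<open>Entries are distinct, so equal ends leave at most one entry. Hence for
  \<open>n \<ge> 2\<close> the same entry cannot be both first and last.\<close>

lemma good_perms_same_ends:
  assumes "xs \<in> good_perms n" "hd xs = last xs"
  shows "n \<le> 1"
proof (cases xs)
  case Nil
  then show ?thesis using set_good_perms[OF assms(1)] by auto
next
  case (Cons x ys)
  have "distinct xs" using assms by (auto simp: good_perms_def permutations_of_set_def)
  then have "ys = []" using assms Cons by (auto split: if_splits)
  then have "{1..n} = {x}" using set_good_perms[OF assms(1)] Cons by simp
  then have "card {1..n} = 1" by simp
  then show ?thesis by simp
qed

text \<open>Removing the leading \<open>Suc n\<close> leaves a list that ends in its maximum
  \<open>n\<close>. It cannot also start with \<open>n\<close>, so it starts with
  \<open>n - 1\<close>: the roles of the two ends are exchanged.\<close>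

lemma max_first_second_last_Suc:
  assumes "n \<ge> 2"
  shows "max_first (Suc n) \<inter> second_last (Suc n) = (#) (Suc n) ` (second_first n \<inter> max_last n)"
proof -
  have ne: "ys \<noteq> []" if "ys \<in> good_perms n" for ys
    using that assms good_perms_not_Nil[of ys n] by simp
  have "Suc n # ys \<in> second_last (Suc n) \<longleftrightarrow> ys \<in> second_first n \<inter> max_last n"
    if "ys \<in> max_first n \<union> second_first n" for ys
  proof -
    have y: "ys \<in> good_perms n" using that by (auto simp: max_first_def second_first_def)
    have "Suc n # ys \<in> good_perms (Suc n)"
      using that assms by (auto simp: Cons_good_perms_iff max_first_def second_first_def)
    then show ?thesis
      using that assms ne[OF y] good_perms_same_ends[OF y]
      by (auto simp: max_first_def second_first_def max_last_def second_last_def)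
  qed
  then show ?thesis using assms by (auto simp: max_first_Suc)
qed

lemma second_first_max_last_Suc:
  assumes "n \<ge> 2"
  shows "second_first (Suc n) \<inter> max_last (Suc n)
    = (\<lambda>ys. ys @ [Suc n]) ` (max_first n \<inter> second_last n)"
proof -
  have ne: "ys \<noteq> []" if "ys \<in> good_perms n" for ys
    using that assms good_perms_not_Nil[of ys n] by simp
  have "ys @ [Suc n] \<in> second_first (Suc n) \<longleftrightarrow> ys \<in> max_first n \<inter> second_last n"
    if "ys \<in> max_last n \<union> second_last n" for ys
  proof -
    have y: "ys \<in> good_perms n" using that by (auto simp: max_last_def second_last_def)
    have "ys @ [Suc n] \<in> good_perms (Suc n)"
      using that assms by (auto simp: snoc_good_perms_iff max_last_def second_last_def)
    then show ?thesis
      using that assms ne[OF y] good_perms_same_ends[OF y]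
      by (auto simp: max_first_def second_first_def max_last_def second_last_def)
  qed
  then show ?thesis using assms by (auto simp: max_last_Suc)
qed

lemma good_perms_2: "good_perms 2 = {[1, 2], [2, 1]}"
proof -
  have "{1..2} = {1, 2::nat}" by auto
  then have "permutations_of_set {1..2} = {[1, 2], [2, 1::nat]}"
    by (simp add: permutations_of_set_doubleton)
  moreover have "[1] @ [Suc 1] \<in> good_perms (Suc 1)"
    by (subst snoc_good_perms_iff) (simp_all add: good_perms_1[simplified])
  moreover have "Suc 1 # [1] \<in> good_perms (Suc 1)"
    by (subst Cons_good_perms_iff) (simp_all add: good_perms_1[simplified])
  ultimately show ?thesis by (auto simp: good_perms_def numeral_2_eq_2)
qed

text \<open>Each class at size \<open>Suc n\<close> is an injective image of the other class at size
  \<open>n\<close>, so both counts are carried through one induction. The member starting with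
  \<open>n\<close> is \<open>n, n - 2, ...\<close> downwards, then the remaining entries upwards to
  \<open>n - 1\<close>.\<close>

lemma card_opposite_ends:
  assumes "n \<ge> 2"
  shows "card (max_first n \<inter> second_last n) = 1 \<and> card (second_first n \<inter> max_last n) = 1"
  using assms
proof (induction n rule: dec_induct)
  case base
  have "max_first 2 \<inter> second_last 2 = {[2, 1]}" "second_first 2 \<inter> max_last 2 = {[1, 2]}"
    by (auto simp: max_first_def second_first_def max_last_def second_last_def good_perms_2)
  then show ?case by simp
next
  case (step n)
  then show ?case
    by (simp add: max_first_second_last_Suc second_first_max_last_Suc card_image inj_on_def)
qed

text \<open>If \<open>n - 1\<close> is last, then \<open>n\<close> is not last, and a start
  \<open>n - 1, n\<close> would repeat \<open>n - 1\<close>. Only a leading \<open>n\<close>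
  remains.\<close>

lemma second_last_eq:
  assumes "n \<ge> 2"
  shows "second_last n = max_first n \<inter> second_last n"
proof
  show "second_last n \<subseteq> max_first n \<inter> second_last n"
  proof
    fix xs assume xs: "xs \<in> second_last n"
    then have g: "xs \<in> good_perms n" and l: "last xs = n - 1" by (auto simp: second_last_def)
    have d: "distinct xs" using g by (auto simp: good_perms_def permutations_of_set_def)
    have "n \<ge> 1" using assms by simp
    with g have "hd xs = n"
    proof (cases rule: good_perms_cases)
      case (second ys)
      then have "n - 1 \<in> set ys" using l by (metis last.simps last_in_set list.distinct(1))
      then show ?thesis using d second by auto
    qed (use l assms in auto)
    with xs g show "xs \<in> max_first n \<inter> second_last n" by (auto simp: max_first_def)
  qed
qed auto

lemma card_second_last: "n \<ge> 2 \<Longrightarrow> card (second_last n) = 1"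
  using second_last_eq card_opposite_ends by metis

text \<open>Removing the final maximum leaves a member of \<open>max_last\<close> or the single
  member of \<open>second_last\<close>, so the count grows by one per size. The induction starts at
  size 2 because \<open>second_last 1\<close> is empty.\<close>

lemma card_max_last: "n \<ge> 1 \<Longrightarrow> card (max_last (Suc n)) = n"
proof (induction n rule: dec_induct)
  case base
  have "max_last 2 = {[1, 2]}" by (auto simp: max_last_def good_perms_2)
  then show ?case by (simp add: numeral_2_eq_2)
next
  case (step n)
  have "max_last (Suc n) \<inter> second_last (Suc n) = {}"
    by (auto simp: max_last_def second_last_def)
  then show ?case
    using step by (simp add: max_last_Suc[of "Suc n"] card_image inj_on_def card_Un_disjoint
        card_second_last)
qed

text \<open>These are the permutations with their maximum strictly inside, where only the third
  alternative of \<open>good_perms_cases\<close> is left.\<close>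

lemma middle_perms_eq:
  assumes "n \<ge> 1"
  shows "good_perms (Suc (Suc n)) - max_first (Suc (Suc n)) - max_last (Suc (Suc n))
    = (\<lambda>ys. Suc n # Suc (Suc n) # ys) ` max_first n" (is "?L = ?R")
proof
  show "?L \<subseteq> ?R"
  proof
    fix xs assume xs: "xs \<in> ?L"
    then have g: "xs \<in> good_perms (Suc (Suc n))" by simp
    have "Suc (Suc n) \<ge> 1" by simp
    with g show "xs \<in> ?R"
    proof (cases rule: good_perms_cases)
      case (second ys)
      then have "ys \<in> max_first n"
        using g assms by (simp add: Cons_Cons_good_perms_iff max_first_def)
      then show ?thesis using second by auto
    qed (use xs in \<open>auto simp: max_first_def max_last_def\<close>)
  qed
  show "?R \<subseteq> ?L"
  proof
    fix xs assume "xs \<in> ?R"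
    then obtain ys where ys: "xs = Suc n # Suc (Suc n) # ys" "ys \<in> good_perms n" "hd ys = n"
      by (auto simp: max_first_def)
    have "ys \<noteq> []" "last ys \<le> n"
      using ys assms good_perms_not_Nil last_good_perms_le by auto
    moreover have "xs \<in> good_perms (Suc (Suc n))"
      using ys assms by (simp add: Cons_Cons_good_perms_iff)
    ultimately show "xs \<in> ?L" using ys by (auto simp: max_first_def max_last_def)
  qed
qed

text \<open>The maximum is not first. Either it is strictly inside, counted by
  \<open>max_first n\<close>, or it is last, which happens for exactly one permutation.\<close>

lemma card_second_first:
  assumes "n \<ge> 1"
  shows "card (second_first (Suc (Suc n))) = card (max_first n) + 1"
proof -
  let ?m = "Suc (Suc n)"
  let ?M = "(\<lambda>ys. Suc n # ?m # ys) ` max_first n"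
  have sub: "?M \<subseteq> second_first ?m"
    using middle_perms_eq[OF assms] by (auto simp: second_first_def)
  have "second_first ?m = ?M \<union> (second_first ?m \<inter> max_last ?m)"
  proof
    show "second_first ?m \<subseteq> ?M \<union> (second_first ?m \<inter> max_last ?m)"
      unfolding middle_perms_eq[OF assms, symmetric] by (auto simp: second_first_def max_first_def)
  qed (use sub in auto)
  moreover have "?M \<inter> (second_first ?m \<inter> max_last ?m) = {}"
    unfolding middle_perms_eq[OF assms, symmetric] by auto
  moreover have "card ?M = card (max_first n)" by (simp add: card_image inj_on_def)
  ultimately show ?thesis
    using card_opposite_ends[of ?m] card_Un_disjoint[of ?M "second_first ?m \<inter> max_last ?m"] by simp
qed

text \<open>Removing the leading \<open>n\<close> leaves a member of
  \<open>max_first (n - 1)\<close> or of \<open>second_first (n - 1)\<close>; the latter number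
  \<open>card (max_first (n - 3)) + 1\<close>.\<close>

lemma card_max_first_rec:
  assumes "n \<ge> 4"
  shows "card (max_first n) = card (max_first (n - 1)) + card (max_first (n - 3)) + 1"
proof -
  have "n = Suc (Suc (Suc (n - 3)))" "n - 3 \<ge> 1"
    using assms by simp_all
  then obtain k where n: "n = Suc (Suc (Suc k))" "k \<ge> 1" by blast
  have "max_first (Suc (Suc k)) \<inter> second_first (Suc (Suc k)) = {}"
    by (auto simp: max_first_def second_first_def)
  then show ?thesis
    using max_first_Suc[of "Suc (Suc k)"] card_second_first[OF n(2)]
    by (simp add: n(1) card_image inj_on_def card_Un_disjoint numeral_3_eq_3)
qed

lemma card_max_first_small:
  "card (max_first 1) = 1" "card (max_first 2) = 1" "card (max_first 3) = 2"
proof -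
  have "max_first 1 = {[1]}" "max_first 2 = {[2, 1]}" "second_first 2 = {[1, 2]}"
    by (auto simp: max_first_def second_first_def good_perms_1[simplified] good_perms_2)
  moreover from this have "max_first (Suc 2) = {[3, 2, 1], [3, 1, 2]}"
    by (subst max_first_Suc) auto
  ultimately show "card (max_first 1) = 1" "card (max_first 2) = 1" "card (max_first 3) = 2"
    by simp_all
qed

section \<open>Recurrences and initial values of \<open>A_num\<close>\<close>

lemma A_num_eq: "A_num n = card (good_perms n)"
  by (simp add: A_num_def good_perms_def)

text \<open>The summands count the permutations with their maximum last, first and strictly inside.
  These classes are disjoint because the ends differ for \<open>n \<ge> 3\<close>.\<close>

lemma A_num_rec:
  assumes "n \<ge> 3"
  shows "A_num n = n - 1 + card (max_first n) + card (max_first (n - 2))"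
proof -
  have "n = Suc (Suc (n - 2))" "n - 2 \<ge> 1"
    using assms by simp_all
  then obtain k where n: "n = Suc (Suc k)" and k: "k \<ge> 1" by blast
  let ?M = "(\<lambda>ys. Suc k # Suc (Suc k) # ys) ` max_first k"
  have M: "?M = good_perms n - max_first n - max_last n"
    using middle_perms_eq[OF k] by (simp add: n)
  have "max_first n \<inter> max_last n = {}"
    using good_perms_same_ends[of _ n] n by (force simp: max_first_def max_last_def)
  moreover have "?M \<inter> (max_first n \<union> max_last n) = {}"
    unfolding M by auto
  moreover have "good_perms n = ?M \<union> (max_first n \<union> max_last n)"
    unfolding M by (auto simp: max_first_def max_last_def)
  moreover have "card ?M = card (max_first k)" by (simp add: card_image inj_on_def)
  ultimately have "card (good_perms n) = card (max_first k) + (card (max_first n) + Suc k)"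
    using card_max_last[of "Suc k"] by (simp add: card_Un_disjoint n)
  then show ?thesis by (simp add: A_num_eq n)
qed

text \<open>The coefficients come from \<open>(1 - x)^2 * (1 - x - x^3) = 1 - 3*x + 3*x^2 - 2*x^3 +
  2*x^4 - x^5\<close>. The bound 8 keeps \<open>n - 5\<close> within the range of
  \<open>A_num_rec\<close>.\<close>

lemma A_num_linear_rec:
  assumes "n \<ge> 8"
  shows "rat_of_nat (A_num n) = 3 * of_nat (A_num (n - 1)) - 3 * of_nat (A_num (n - 2))
    + 2 * of_nat (A_num (n - 3)) - 2 * of_nat (A_num (n - 4)) + of_nat (A_num (n - 5))"
proof -
  obtain k where n: "n = k + 8" using assms by (auto simp: le_iff_add add.commute)
  have f: "card (max_first (k + 8)) = card (max_first (k + 7)) + card (max_first (k + 5)) + 1"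
    "card (max_first (k + 7)) = card (max_first (k + 6)) + card (max_first (k + 4)) + 1"
    "card (max_first (k + 6)) = card (max_first (k + 5)) + card (max_first (k + 3)) + 1"
    "card (max_first (k + 5)) = card (max_first (k + 4)) + card (max_first (k + 2)) + 1"
    "card (max_first (k + 4)) = card (max_first (k + 3)) + card (max_first (k + 1)) + 1"
    subgoal using card_max_first_rec[of "k + 8"] by (simp add: add.commute)
    subgoal using card_max_first_rec[of "k + 7"] by (simp add: add.commute)
    subgoal using card_max_first_rec[of "k + 6"] by (simp add: add.commute)
    subgoal using card_max_first_rec[of "k + 5"] by (simp add: add.commute)
    subgoal using card_max_first_rec[of "k + 4"] by (simp add: add.commute)
    done
  have a: "A_num (k + 8) = k + 7 + card (max_first (k + 8)) + card (max_first (k + 6))"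
    "A_num (k + 7) = k + 6 + card (max_first (k + 7)) + card (max_first (k + 5))"
    "A_num (k + 6) = k + 5 + card (max_first (k + 6)) + card (max_first (k + 4))"
    "A_num (k + 5) = k + 4 + card (max_first (k + 5)) + card (max_first (k + 3))"
    "A_num (k + 4) = k + 3 + card (max_first (k + 4)) + card (max_first (k + 2))"
    "A_num (k + 3) = k + 2 + card (max_first (k + 3)) + card (max_first (k + 1))"
    subgoal using A_num_rec[of "k + 8"] by (simp add: add.commute)
    subgoal using A_num_rec[of "k + 7"] by (simp add: add.commute)
    subgoal using A_num_rec[of "k + 6"] by (simp add: add.commute)
    subgoal using A_num_rec[of "k + 5"] by (simp add: add.commute)
    subgoal using A_num_rec[of "k + 4"] by (simp add: add.commute)
    subgoal using A_num_rec[of "k + 3"] by (simp add: add.commute)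
    done
  \<comment> \<open>Negative terms are moved across, so the identity holds over the naturals without
    truncated subtraction; the values of \<open>max_first\<close> cancel.\<close>
  have "A_num (k + 8) + 3 * A_num (k + 6) + 2 * A_num (k + 4)
      = 3 * A_num (k + 7) + 2 * A_num (k + 5) + A_num (k + 3)"
    using f a by linarith
  then have "rat_of_nat (A_num (k + 8) + 3 * A_num (k + 6) + 2 * A_num (k + 4))
      = rat_of_nat (3 * A_num (k + 7) + 2 * A_num (k + 5) + A_num (k + 3))"
    by (rule arg_cong)
  then show ?thesis by (simp add: n algebra_simps)
qed

lemma A_num_small:
  "A_num 1 = 1" "A_num 2 = 2" "A_num 3 = 5" "A_num 4 = 8" "A_num 5 = 12" "A_num 6 = 18"
  "A_num 7 = 26"
proof -
  note [simp] = card_max_first_small card_max_first_small(1)[simplified]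
  have [simp]: "card (max_first 4) = 4" by (simp add: card_max_first_rec)
  have [simp]: "card (max_first 5) = 6" by (simp add: card_max_first_rec)
  have [simp]: "card (max_first 6) = 9" by (simp add: card_max_first_rec)
  have [simp]: "card (max_first 7) = 14" by (simp add: card_max_first_rec)
  show "A_num 3 = 5" "A_num 4 = 8" "A_num 5 = 12" "A_num 6 = 18" "A_num 7 = 26"
    by (simp_all add: A_num_rec)
  show "A_num 1 = 1" "A_num 2 = 2"
    by (simp_all add: A_num_eq good_perms_2 good_perms_1[simplified])
qed

section \<open>The generating function\<close>

theorem mainTheorem6:
  shows "A_gf =
    (- (fps_X ^ 6) + fps_X ^ 5 - 3 * fps_X ^ 4 + 2 * fps_X ^ 3 - fps_X ^ 2 + fps_X)
      / ((1 - fps_X) ^ 2 * (1 - fps_X - fps_X ^ 3))"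
proof -
  have ring: "a * ((1 - x) ^ 2 * (1 - x - x ^ 3)) =
      a - 3 * (x * a) + 3 * (x ^ 2 * a) - 2 * (x ^ 3 * a) + 2 * (x ^ 4 * a) - x ^ 5 * a"
    for a x :: "rat fps"
    by algebra
  let ?N = "- (fps_X ^ 6) + fps_X ^ 5 - 3 * fps_X ^ 4 + 2 * fps_X ^ 3 - fps_X ^ 2 + fps_X :: rat fps"
  let ?D = "(1 - fps_X) ^ 2 * (1 - fps_X - fps_X ^ 3) :: rat fps"
  \<comment> \<open>Constants as \<open>fps_const\<close> and every shift as a power, even
    \<open>fps_X ^ 1\<close>, let one rule compute all shifted coefficients.\<close>
  have "A_gf * ?D = A_gf - fps_const 3 * (fps_X ^ 1 * A_gf) + fps_const 3 * (fps_X ^ 2 * A_gf)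
      - fps_const 2 * (fps_X ^ 3 * A_gf) + fps_const 2 * (fps_X ^ 4 * A_gf) - fps_X ^ 5 * A_gf"
    by (simp add: ring numeral_fps_const)
  also have "\<dots> = - (fps_X ^ 6) + fps_X ^ 5 - fps_const 3 * fps_X ^ 4 + fps_const 2 * fps_X ^ 3
      - fps_X ^ 2 + fps_X ^ 1" (is "?l = ?r")
  proof (rule fps_ext)
    fix n :: nat
    \<comment> \<open>From 8 on, the recurrence makes the coefficient vanish. Below that, including
      7 just past the degree of the numerator, the computed values decide.\<close>
    consider "n \<ge> 8" | "n = 0" | "n = 1" | "n = 2" | "n = 3" | "n = 4" | "n = 5" | "n = 6" | "n = 7"
      by linarith
    then show "fps_nth ?l n = fps_nth ?r n"
    proof cases
      case 1
      \<comment> \<open>No shifted index reaches 0, so the coefficient of \<open>A_gf\<close> that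
        is set to 0 by hand does not enter.\<close>
      then have [simp]: "Suc 0 \<le> n - i" if "i < 8" for i
        using that by simp
      show ?thesis
        using 1 A_num_linear_rec[OF 1]
        by (simp add: A_gf_def fps_X_power_mult_nth del: power_one_right)
    qed (simp_all add: A_gf_def fps_X_power_mult_nth A_num_small
        A_num_small(1)[simplified] del: power_one_right)
  qed
  also have "\<dots> = ?N"
    by (simp add: numeral_fps_const)
  finally have "A_gf * ?D = ?N" .
  \<comment> \<open>The denominator has constant coefficient 1, so it is nonzero and can be
    cancelled.\<close>
  moreover have "fps_nth ?D 0 \<noteq> 0" by (simp add: power2_eq_square)
  then have "?D \<noteq> 0" by (metis fps_zero_nth)
  ultimately show ?thesis by (metis nonzero_mult_div_cancel_right)
qed

end
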